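(* Let $M>0$. Then: (i) $\beta_M(x)\le0$ for every $x\in S$; (ii) if $\bar x\in S$ is not a stationary point, then $\beta_M(\bar x)<0$ and $d_M(\bar x)\ne0$; (iii) if $\beta_M(\bar x)=0$ for some $\bar x\in S$, then $\bar x$ is a stationary point.
   Context: Setting: $S\subseteq\mathbb{R}^n$ is a nonempty closed convex set with nonempty interior, $K\subset\mathbb{R}^p$ is a pointed closed convex cone, $f=(f_1,\dots,f_p)^\top:S\to\mathbb{R}^p$ is twice continuously differentiable, with Jacobian $Jf(x)$ ($p\times n$). With $K^*=\{u:\langle u,\xi\rangle\ge0\ \forall\xi\in K\}$, there is a finite set $C\subset K^*$ of unit vectors with $\mathrm{cone}(\mathrm{conv}(C))=K^*$ (so $\mathrm{int}(K)=\{u:\langle u,\xi\rangle>0\ \forall\xi\in C\}$). A point $\bar x\in S$ is stationary (Pareto critical) if $R(Jf(\bar x))\cap(-\mathrm{int}(K))=\emptyset$, where $R(Jf(\bar x))$ is the range of $Jf(\bar x)$. Notation: $\langle Jf(x)d,\xi\rangle=\sum_i\xi_i\nabla f_i(x)^\top d$, $\langle d^\top\nabla^2f(x)d,\xi\rangle=\sum_i\xi_i d^\top\nabla^2 f_i(x)d$. For $x\in S$: $q_M(x,d)=\max_{\xi\in C}\{\langle Jf(x)d,\xi\rangle+\tfrac12\langle d^\top\nabla^2f(x)d,\xi\rangle\}+\tfrac M6\|d\|^3$, $d_M(x)$ a (fixed) global minimizer of $q_M(x,\cdot)$ over $\mathbb{R}^n$, and $\beta_M(x)=\min_{d\in\mathbb{R}^n}q_M(x,d)$.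 *)

theory Defs
  imports "HOL-Analysis.Analysis"
begin

(* Dual cone K^* = {u. <u,xi> >= 0 for all xi in K} *)
definition dual_cone :: "(real^'p) set \<Rightarrow> (real^'p) set" where
  "dual_cone K = {u. \<forall>\<xi>\<in>K. u \<bullet> \<xi> \<ge> 0}"

(* pointed closed convex cone *)
definition pointed_closed_convex_cone :: "(real^'p) set \<Rightarrow> bool" where
  "pointed_closed_convex_cone K \<longleftrightarrow>
     K \<noteq> {} \<and> cone K \<and> convex K \<and> closed K \<and> K \<inter> uminus ` K = {0}"

(* Jf x :: real^'n^'p is the Jacobian (p x n); its i-th row is grad f_i(x).
   Hf x i :: real^'n^'n is the Hessian of f_i at x. *)

(* q_M(x,d) *)
definition qM :: "(real^'n \<Rightarrow> real^'n^'p) \<Rightarrow> (real^'n \<Rightarrow> 'p \<Rightarrow> real^'n^'n)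
    \<Rightarrow> (real^'p) set \<Rightarrow> real \<Rightarrow> real^'n \<Rightarrow> real^'n \<Rightarrow> real" where
  "qM Jf Hf C M x d =
     Max ((\<lambda>\<xi>. (Jf x *v d) \<bullet> \<xi> + 1/2 * (\<Sum>i\<in>UNIV. \<xi> $ i * (d \<bullet> (Hf x i *v d)))) ` C)
     + M / 6 * norm d ^ 3"

(* beta_M(x) = min_d q_M(x,d) *)
definition betaM :: "(real^'n \<Rightarrow> real^'n^'p) \<Rightarrow> (real^'n \<Rightarrow> 'p \<Rightarrow> real^'n^'n)
    \<Rightarrow> (real^'p) set \<Rightarrow> real \<Rightarrow> real^'n \<Rightarrow> real" where
  "betaM Jf Hf C M x = (INF d. qM Jf Hf C M x d)"

(* Pareto critical: R(Jf(x)) \<inter> (- int K) = {} *)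
definition stationary :: "(real^'n \<Rightarrow> real^'n^'p) \<Rightarrow> (real^'p) set \<Rightarrow> real^'n \<Rightarrow> bool" where
  "stationary Jf K x \<longleftrightarrow> range (\<lambda>d. Jf x *v d) \<inter> uminus ` interior K = {}"

end

theory Submission
  imports Defs
begin

text \<open>Every \<open>\<xi> \<in> C\<close> is a nonzero element of \<open>K\<^sup>*\<close>, hence strictly positive on
  \<open>int K\<close>. So if \<open>x\<close> is not stationary, some \<open>d\<close> with \<open>Jf(x) d \<in> -int K\<close> makes every
  linear term \<open>\<langle>Jf(x) d, \<xi>\<rangle>\<close> negative, and along \<open>t d\<close> the model is at most
  \<open>t (A + B t + c t\<^sup>2)\<close> with \<open>A < 0\<close>, which is negative for small \<open>t > 0\<close>. As \<open>q\<^sub>M(x, 0) = 0\<close>,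
  this forces \<open>\<beta>\<^sub>M(x) < 0\<close> and rules out \<open>d\<^sub>M(x) = 0\<close>. For \<open>\<beta>\<^sub>M(x) \<le> q\<^sub>M(x, 0) = 0\<close> one needs
  the cubic term: it makes \<open>q\<^sub>M(x, \<cdot>)\<close> bounded below, without which the real infimum in
  \<open>betaM\<close> would be a junk value. Only the data at the single point \<open>x\<close> enter.\<close>

lemma bdd_below_image_atLeast_if_filterlim_at_top:
  fixes g :: "real \<Rightarrow> real"
  assumes "continuous_on {a..} g" and "filterlim g at_top at_top"
  shows "bdd_below (g ` {a..})"
proof -
  obtain T where T: "\<And>t. t \<ge> T \<Longrightarrow> g t \<ge> 0"
    using filterlim_at_top[THEN iffD1, OF assms(2), rule_format, of 0]
    by (auto simp: eventually_at_top_linorder)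
  have "compact (g ` {a..T})"
    by (rule compact_continuous_image) (auto intro: continuous_on_subset[OF assms(1)])
  then obtain m where "\<And>t. t \<in> {a..T} \<Longrightarrow> m \<le> g t"
    using bounded_has_Inf(1)[OF compact_imp_bounded] by blast
  then have "\<And>t. t \<ge> a \<Longrightarrow> min m 0 \<le> g t"
    using T by (metis atLeastAtMost_iff linorder_le_cases min.coboundedI1 min.coboundedI2)
  then show ?thesis
    by (auto simp: bdd_below_def)
qed

lemma filterlim_cubic_at_top:
  fixes a b c :: real
  assumes "c > 0"
  shows "filterlim (\<lambda>t. - a * t - b * t\<^sup>2 + c * t ^ 3) at_top at_top"
proof -
  have "((\<lambda>t. b / t) \<longlongrightarrow> 0) at_top" "((\<lambda>t. a / t\<^sup>2) \<longlongrightarrow> 0) at_top"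
    by (intro tendsto_divide_0[OF tendsto_const] filterlim_at_top_imp_at_infinity
        filterlim_pow_at_top filterlim_ident; simp)+
  then have "((\<lambda>t. c - b / t - a / t\<^sup>2) \<longlongrightarrow> c) at_top"
    using tendsto_diff[OF tendsto_diff[OF tendsto_const]] by fastforce
  then have "filterlim (\<lambda>t. (c - b / t - a / t\<^sup>2) * t ^ 3) at_top at_top"
    using assms by (intro filterlim_tendsto_pos_mult_at_top filterlim_pow_at_top filterlim_ident) simp_all
  moreover have "eventually (\<lambda>t. (c - b / t - a / t\<^sup>2) * t ^ 3 = - a * t - b * t\<^sup>2 + c * t ^ 3) at_top"
    using eventually_gt_at_top[of 0]
    by eventually_elim (simp add: field_simps power2_eq_square power3_eq_cube)
  ultimately show ?thesis
    using filterlim_cong by fastforce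
qed

lemma exists_pos_quadratic_neg:
  fixes A B c :: real
  assumes "A < 0"
  shows "\<exists>t>0. A + B * t + c * t\<^sup>2 < 0"
proof -
  have "((\<lambda>t. A + B * t + c * t\<^sup>2) \<longlongrightarrow> A) (at_right 0)"
    by (auto intro!: tendsto_eq_intros)
  then have "eventually (\<lambda>t. A + B * t + c * t\<^sup>2 < 0) (at_right (0::real))"
    using assms by (rule order_tendstoD(2))
  then have "eventually (\<lambda>t. t > 0 \<and> A + B * t + c * t\<^sup>2 < 0) (at_right (0::real))"
    by (intro eventually_conj eventually_at_right_less)
  then show ?thesis
    using eventually_happens'[OF trivial_limit_at_right_real] by blast
qed

lemma abs_hessian_form_le:
  fixes H :: "'p::finite \<Rightarrow> real^'n::finite^'n" and \<xi> :: "real^'p"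
  shows "\<bar>\<Sum>i\<in>UNIV. \<xi> $ i * (d \<bullet> (H i *v d))\<bar>
     \<le> (\<Sum>i\<in>UNIV. \<bar>\<xi> $ i\<bar> * onorm ((*v) (H i))) * (norm d)\<^sup>2"
proof -
  have "\<bar>d \<bullet> (H i *v d)\<bar> \<le> onorm ((*v) (H i)) * (norm d)\<^sup>2" for i
  proof -
    have "\<bar>d \<bullet> (H i *v d)\<bar> \<le> norm d * norm (H i *v d)"
      by (rule Cauchy_Schwarz_ineq2)
    also have "\<dots> \<le> norm d * (onorm ((*v) (H i)) * norm d)"
      by (rule mult_left_mono[OF onorm]) auto
    finally show ?thesis
      by (simp add: power2_eq_square algebra_simps)
  qed
  then have "\<bar>\<xi> $ i * (d \<bullet> (H i *v d))\<bar> \<le> \<bar>\<xi> $ i\<bar> * onorm ((*v) (H i)) * (norm d)\<^sup>2" for i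
    by (simp add: abs_mult mult.assoc mult_left_mono)
  then show ?thesis
    by (auto simp: sum_distrib_right intro: order_trans[OF sum_abs sum_mono])
qed

lemma qM_zero:
  assumes "finite C" "C \<noteq> {}"
  shows "qM Jf Hf C M x 0 = 0"
  using assms by (simp add: qM_def)

lemma bdd_below_qM:
  assumes "finite C" "C \<noteq> {}" "M > 0"
  shows "bdd_below (range (qM Jf Hf C M x))"
proof -
  obtain \<xi> where "\<xi> \<in> C"
    using assms by auto
  define a where "a = onorm ((*v) (Jf x)) * norm \<xi>"
  define b where "b = 1/2 * (\<Sum>i\<in>UNIV. \<bar>\<xi> $ i\<bar> * onorm ((*v) (Hf x i)))"
  define g where "g t = - a * t - b * t\<^sup>2 + M/6 * t ^ 3" for t
  have "continuous_on {0..} g"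
    unfolding g_def by (intro continuous_intros)
  moreover have "filterlim g at_top at_top"
    unfolding g_def using \<open>M > 0\<close> by (intro filterlim_cubic_at_top) simp
  ultimately obtain m where m: "\<And>t. t \<ge> 0 \<Longrightarrow> m \<le> g t"
    using bdd_below_image_atLeast_if_filterlim_at_top unfolding bdd_below_def by fastforce
  have "g (norm d) \<le> qM Jf Hf C M x d" for d
  proof -
    have "\<bar>(Jf x *v d) \<bullet> \<xi>\<bar> \<le> norm (Jf x *v d) * norm \<xi>"
      by (rule Cauchy_Schwarz_ineq2)
    also have "\<dots> \<le> a * norm d"
      unfolding a_def by (metis mult.commute mult.left_commute mult_right_mono norm_ge_zero
          onorm[OF matrix_vector_mul_bounded_linear])
    finally have lin: "- a * norm d \<le> (Jf x *v d) \<bullet> \<xi>"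
      by linarith
    have quad: "- b * (norm d)\<^sup>2 \<le> 1/2 * (\<Sum>i\<in>UNIV. \<xi> $ i * (d \<bullet> (Hf x i *v d)))"
      using abs_hessian_form_le[of \<xi> d "Hf x"] unfolding b_def by (simp add: abs_le_iff)
    have "(Jf x *v d) \<bullet> \<xi> + 1/2 * (\<Sum>i\<in>UNIV. \<xi> $ i * (d \<bullet> (Hf x i *v d)))
       \<le> Max ((\<lambda>\<xi>. (Jf x *v d) \<bullet> \<xi> + 1/2 * (\<Sum>i\<in>UNIV. \<xi> $ i * (d \<bullet> (Hf x i *v d)))) ` C)"
      using assms \<open>\<xi> \<in> C\<close> by (intro Max_ge) auto
    then show ?thesis
      using lin quad unfolding qM_def g_def by linarith
  qed
  then show ?thesis
    using m by (metis bdd_belowI2 norm_ge_zero order_trans)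
qed

lemma betaM_le_qM:
  assumes "finite C" "C \<noteq> {}" "M > 0"
  shows "betaM Jf Hf C M x \<le> qM Jf Hf C M x d"
  unfolding betaM_def by (rule cINF_lower[OF bdd_below_qM[OF assms]]) simp

lemma qM_scaleR_le:
  assumes "finite C" "C \<noteq> {}" "t \<ge> 0"
  shows "qM Jf Hf C M x (t *\<^sub>R d) \<le>
    t * Max ((\<lambda>\<xi>. (Jf x *v d) \<bullet> \<xi>) ` C)
    + t\<^sup>2 * Max ((\<lambda>\<xi>. 1/2 * (\<Sum>i\<in>UNIV. \<xi> $ i * (d \<bullet> (Hf x i *v d)))) ` C)
    + t ^ 3 * (M/6 * norm d ^ 3)"
proof -
  let ?L = "\<lambda>\<xi>. (Jf x *v d) \<bullet> \<xi>"
  let ?Q = "\<lambda>\<xi>. 1/2 * (\<Sum>i\<in>UNIV. \<xi> $ i * (d \<bullet> (Hf x i *v d)))"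
  have term_le: "(Jf x *v (t *\<^sub>R d)) \<bullet> \<xi> + 1/2 * (\<Sum>i\<in>UNIV. \<xi> $ i * ((t *\<^sub>R d) \<bullet> (Hf x i *v (t *\<^sub>R d))))
      \<le> t * Max (?L ` C) + t\<^sup>2 * Max (?Q ` C)" if "\<xi> \<in> C" for \<xi>
  proof -
    have "(Jf x *v (t *\<^sub>R d)) \<bullet> \<xi> + 1/2 * (\<Sum>i\<in>UNIV. \<xi> $ i * ((t *\<^sub>R d) \<bullet> (Hf x i *v (t *\<^sub>R d))))
        = t * ?L \<xi> + t\<^sup>2 * ?Q \<xi>"
      by (simp add: matrix_vector_mult_scaleR sum_distrib_left power2_eq_square algebra_simps)
    moreover have "t * ?L \<xi> \<le> t * Max (?L ` C)"
      using assms that by (intro mult_left_mono Max_ge) auto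
    moreover have "?Q \<xi> \<le> Max (?Q ` C)"
      by (rule Max_ge) (use assms that in simp_all)
    then have "t\<^sup>2 * ?Q \<xi> \<le> t\<^sup>2 * Max (?Q ` C)"
      by (rule mult_left_mono) simp
    ultimately show ?thesis
      by linarith
  qed
  have "Max ((\<lambda>\<xi>. (Jf x *v (t *\<^sub>R d)) \<bullet> \<xi>
        + 1/2 * (\<Sum>i\<in>UNIV. \<xi> $ i * ((t *\<^sub>R d) \<bullet> (Hf x i *v (t *\<^sub>R d))))) ` C)
      \<le> t * Max (?L ` C) + t\<^sup>2 * Max (?Q ` C)"
    using assms term_le by (intro Max.boundedI finite_imageI) blast+
  moreover have "M/6 * norm (t *\<^sub>R d) ^ 3 = t ^ 3 * (M/6 * norm d ^ 3)"
    using assms by (simp add: power_mult_distrib)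
  ultimately show ?thesis
    unfolding qM_def by linarith
qed

lemma qM_neg_if_descent_direction:
  assumes "finite C" "C \<noteq> {}"
    and "\<forall>\<xi>\<in>C. (Jf x *v d) \<bullet> \<xi> < 0"
  shows "\<exists>t>0. qM Jf Hf C M x (t *\<^sub>R d) < 0"
proof -
  define A where "A = Max ((\<lambda>\<xi>. (Jf x *v d) \<bullet> \<xi>) ` C)"
  define B where "B = Max ((\<lambda>\<xi>. 1/2 * (\<Sum>i\<in>UNIV. \<xi> $ i * (d \<bullet> (Hf x i *v d)))) ` C)"
  have "A < 0"
    unfolding A_def using assms by simp
  then obtain t where "t > 0" and "A + B * t + (M/6 * norm d ^ 3) * t\<^sup>2 < 0"
    using exists_pos_quadratic_neg by blast
  then have "t * (A + B * t + (M/6 * norm d ^ 3) * t\<^sup>2) < 0"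
    by (simp add: mult_pos_neg)
  moreover have "qM Jf Hf C M x (t *\<^sub>R d) \<le> t * (A + B * t + (M/6 * norm d ^ 3) * t\<^sup>2)"
    using qM_scaleR_le[OF assms(1,2), of t] \<open>t > 0\<close> unfolding A_def B_def
    by (simp add: algebra_simps power2_eq_square power3_eq_cube)
  ultimately show ?thesis
    using \<open>t > 0\<close> by force
qed

lemma inner_pos_if_interior_dual_cone:
  assumes "u \<in> interior K" and "\<xi> \<in> dual_cone K" and "\<xi> \<noteq> 0"
  shows "u \<bullet> \<xi> > 0"
proof -
  obtain e where "e > 0" "ball u e \<subseteq> K"
    using assms(1) by (meson mem_interior)
  define v where "v = u - (e / (2 * norm \<xi>)) *\<^sub>R \<xi>"
  have "dist u v = e / 2"
    unfolding v_def dist_norm using \<open>e > 0\<close> \<open>\<xi> \<noteq> 0\<close> by simp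
  then have "v \<in> K"
    using \<open>e > 0\<close> \<open>ball u e \<subseteq> K\<close> by auto
  then have "0 \<le> v \<bullet> \<xi>"
    using assms(2) unfolding dual_cone_def by (auto simp: inner_commute)
  moreover have "v \<bullet> \<xi> = u \<bullet> \<xi> - e / 2 * norm \<xi>"
    unfolding v_def using \<open>\<xi> \<noteq> 0\<close> by (simp add: inner_diff_left dot_square_norm power2_eq_square)
  moreover have "e / 2 * norm \<xi> > 0"
    using \<open>e > 0\<close> \<open>\<xi> \<noteq> 0\<close> by simp
  ultimately show ?thesis
    by linarith
qed

lemma descent_direction_if_not_stationary:
  assumes "\<not> stationary Jf K x" and "C \<subseteq> dual_cone K" and "0 \<notin> C"
  obtains d where "\<forall>\<xi>\<in>C. (Jf x *v d) \<bullet> \<xi> < 0"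
proof -
  obtain d u where "u \<in> interior K" "Jf x *v d = - u"
    using assms(1) unfolding stationary_def by auto
  then have "\<forall>\<xi>\<in>C. (Jf x *v d) \<bullet> \<xi> < 0"
    using inner_pos_if_interior_dual_cone assms(2,3) by fastforce
  then show thesis ..
qed

lemma nonempty_if_cone_hull_convex_hull_eq_dual_cone:
  assumes "cone hull (convex hull C) = dual_cone K"
  shows "C \<noteq> {}"
proof
  assume "C = {}"
  then have "dual_cone K = {}"
    using assms by (metis cone_empty convex_hull_empty hull_same)
  moreover have "0 \<in> dual_cone K"
    unfolding dual_cone_def by simp
  ultimately show False
    by simp
qed

theorem theorem3p1:
  fixes S :: "(real^'n) set" and K :: "(real^'p) set" and C :: "(real^'p) set"
    and f :: "real^'n \<Rightarrow> real^'p"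
    and Jf :: "real^'n \<Rightarrow> real^'n^'p" and Hf :: "real^'n \<Rightarrow> 'p \<Rightarrow> real^'n^'n"
    and M :: real
  assumes S: "closed S" "convex S" "interior S \<noteq> {}"
    and K: "pointed_closed_convex_cone K"
    and C: "finite C" "C \<subseteq> dual_cone K" "\<forall>\<xi>\<in>C. norm \<xi> = 1"
           "cone hull (convex hull C) = dual_cone K"
    and f1: "\<And>x. x \<in> S \<Longrightarrow> (f has_derivative (\<lambda>d. Jf x *v d)) (at x within S)"
    and f2: "\<And>x i. x \<in> S \<Longrightarrow> ((\<lambda>y. Jf y $ i) has_derivative (\<lambda>d. Hf x i *v d)) (at x within S)"
    and f3: "\<And>i. continuous_on S (\<lambda>x. Hf x i)"
    and M: "M > 0"
  shows "(\<forall>x\<in>S. betaM Jf Hf C M x \<le> 0)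
    \<and> (\<forall>xb\<in>S. \<not> stationary Jf K xb \<longrightarrow>
          betaM Jf Hf C M xb < 0
          \<and> (\<forall>dM. (\<forall>d. qM Jf Hf C M xb dM \<le> qM Jf Hf C M xb d) \<longrightarrow> dM \<noteq> 0))
    \<and> (\<forall>xb\<in>S. betaM Jf Hf C M xb = 0 \<longrightarrow> stationary Jf K xb)"
proof -
  have "C \<noteq> {}" "0 \<notin> C"
    using C(3,4) nonempty_if_cone_hull_convex_hull_eq_dual_cone by fastforce+
  note q0 = qM_zero[OF C(1) \<open>C \<noteq> {}\<close>] and beta_le = betaM_le_qM[OF C(1) \<open>C \<noteq> {}\<close> M]
  have model_neg: "\<exists>d. qM Jf Hf C M x d < 0" if not_stationary: "\<not> stationary Jf K x" for x
  proof -
    obtain d where "\<forall>\<xi>\<in>C. (Jf x *v d) \<bullet> \<xi> < 0"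
      using descent_direction_if_not_stationary[OF not_stationary C(2) \<open>0 \<notin> C\<close>] .
    then show ?thesis
      using qM_neg_if_descent_direction[OF C(1) \<open>C \<noteq> {}\<close>] by blast
  qed
  have beta_neg: "betaM Jf Hf C M x < 0" if "\<not> stationary Jf K x" for x
    using model_neg[OF that] beta_le by (meson le_less_trans)
  have minimizer_nonzero: "dM \<noteq> 0"
    if "\<not> stationary Jf K x" "\<forall>d. qM Jf Hf C M x dM \<le> qM Jf Hf C M x d" for x dM
    using model_neg[OF that(1)] that(2) q0 by (metis not_le)
  have beta_nonpos: "betaM Jf Hf C M x \<le> 0" for x
    using beta_le[where d=0] by (simp add: q0)
  show ?thesis
    using beta_nonpos beta_neg minimizer_nonzero by (metis less_irrefl)
qed

end
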